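(* Let $\varepsilon(t)$ and $\zeta(t)$ be independent continuous-time Markov chains, each with state space $\{0,1\}$. Let $\lambda_1^{\varepsilon}$ and $\lambda_2^{\varepsilon}$ be the transition rates of $\varepsilon$ out of states $0$ and $1$ respectively, and $\lambda_1^{\zeta}$ and $\lambda_2^{\zeta}$ those of $\zeta$ out of states $0$ and $1$ respectively. Define a process $\xi(t)$ with values in $\{1,2,3,4\}$ by: $\xi(t)=1$ if $(\varepsilon(t),\zeta(t))=(0,0)$; $\xi(t)=2$ if $(\varepsilon(t),\zeta(t))=(1,0)$; $\xi(t)=3$ if $(\varepsilon(t),\zeta(t))=(0,1)$; $\xi(t)=4$ if $(\varepsilon(t),\zeta(t))=(1,1)$. Then $\xi$ is a continuous-time Markov chain whose generator matrix is $$Q=\begin{bmatrix}-(\lambda_1^{\varepsilon}+\lambda_1^{\zeta})&\lambda_1^{\varepsilon}&\lambda_1^{\zeta}&0\\ \lambda_2^{\varepsilon}&-(\lambda_2^{\varepsilon}+\lambda_1^{\zeta})&0&\lambda_1^{\zeta}\\ \lambda_2^{\zeta}&0&-(\lambda_1^{\varepsilon}+\lambda_2^{\zeta})&\lambda_1^{\varepsilon}\\ 0&\lambda_2^{\zeta}&\lambda_2^{\varepsilon}&-(\lambda_2^{\varepsilon}+\lambda_2^{\zeta})\end{bmatrix},$$ where the entry in row $k$ and column $l$, $k\neq l$, is the transition rate from state $k$ to state $l$.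
   Context: All transition rates $\lambda_1^{\varepsilon},\lambda_2^{\varepsilon},\lambda_1^{\zeta},\lambda_2^{\zeta}$ are positive constants (time-homogeneous chains). The transition rate from $k$ to $l\neq k$ of a chain $\xi$ is $\lim_{h\downarrow0}P(\xi(t+h)=l\mid\xi(t)=k)/h$, and diagonal entries of a generator matrix make the rows sum to zero. *)

theory Defs
  imports "HOL-Probability.Probability"
begin

text \<open>
  Processes are indexed by \<open>real\<close>, but only times \<open>t \<ge> 0\<close> are ever constrained.
  Since \<^const>\<open>cond_prob\<close> is \<open>0\<close> when the conditioning event is null, every conditional
  probability below is guarded by the positivity of its conditioning event.
\<close>

text \<open>Time-homogeneous continuous-time Markov chain with finite state space \<open>S\<close>.\<close>

locale ct_markov_chain = prob_space M
  for M :: "'a measure" and S :: "'s set" and X :: "real \<Rightarrow> 'a \<Rightarrow> 's" +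
  assumes finite_states: "finite S"
    and random_state: "\<And>t. 0 \<le> t \<Longrightarrow> X t \<in> measurable M (count_space S)"
    and markov: "\<And>(n::nat) (t :: nat \<Rightarrow> real) (x :: nat \<Rightarrow> 's).
      \<lbrakk>0 \<le> t 0; \<And>i. i \<le> n \<Longrightarrow> t i < t (Suc i); \<And>i. i \<le> Suc n \<Longrightarrow> x i \<in> S;
       \<P>(\<omega> in M. \<forall>i\<le>n. X (t i) \<omega> = x i) > 0\<rbrakk> \<Longrightarrow>
      \<P>(\<omega> in M. X (t (Suc n)) \<omega> = x (Suc n) \<bar> (\<forall>i\<le>n. X (t i) \<omega> = x i)) =
      \<P>(\<omega> in M. X (t (Suc n)) \<omega> = x (Suc n) \<bar> X (t n) \<omega> = x n)"
    and homogeneous: "\<And>s t h k l.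
      \<lbrakk>0 \<le> s; 0 \<le> t; 0 \<le> h; k \<in> S; l \<in> S;
       \<P>(\<omega> in M. X s \<omega> = k) > 0; \<P>(\<omega> in M. X t \<omega> = k) > 0\<rbrakk> \<Longrightarrow>
      \<P>(\<omega> in M. X (s + h) \<omega> = l \<bar> X s \<omega> = k) =
      \<P>(\<omega> in M. X (t + h) \<omega> = l \<bar> X t \<omega> = k)"

text \<open>
  The first conjunct makes the rate well defined: without it, every \<open>q\<close> would vacuously be
  the rate out of a state that is never occupied with positive probability.
\<close>

definition has_transition_rate ::
  "'a measure \<Rightarrow> (real \<Rightarrow> 'a \<Rightarrow> 's) \<Rightarrow> 's \<Rightarrow> 's \<Rightarrow> real \<Rightarrow> bool" where
  "has_transition_rate M X k l q \<longleftrightarrow>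
     (\<exists>t\<ge>0. \<P>(\<omega> in M. X t \<omega> = k) > 0) \<and>
     (\<forall>t\<ge>0. \<P>(\<omega> in M. X t \<omega> = k) > 0 \<longrightarrow>
        ((\<lambda>h. \<P>(\<omega> in M. X (t + h) \<omega> = l \<bar> X t \<omega> = k) / h) \<longlongrightarrow> q) (at_right 0))"

definition has_generator ::
  "'a measure \<Rightarrow> 's set \<Rightarrow> (real \<Rightarrow> 'a \<Rightarrow> 's) \<Rightarrow> ('s \<Rightarrow> 's \<Rightarrow> real) \<Rightarrow> bool" where
  "has_generator M S X Q \<longleftrightarrow>
     (\<forall>k\<in>S. \<forall>l\<in>S. k \<noteq> l \<longrightarrow> has_transition_rate M X k l (Q k l)) \<and>
     (\<forall>k\<in>S. (\<Sum>l\<in>S. Q k l) = 0)"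

text \<open>
  Independence of whole processes: the random trajectories are independent as random
  variables in the product \<open>\<sigma>\<close>-algebras over the time set \<open>[0, \<infinity>)\<close>.
\<close>

definition indep_processes ::
  "'a measure \<Rightarrow> 's set \<Rightarrow> (real \<Rightarrow> 'a \<Rightarrow> 's) \<Rightarrow> 's set \<Rightarrow> (real \<Rightarrow> 'a \<Rightarrow> 's) \<Rightarrow> bool" where
  "indep_processes M S X T Y \<longleftrightarrow>
     prob_space.indep_var M
       (PiM {0..} (\<lambda>_. count_space S)) (\<lambda>\<omega>. \<lambda>t\<in>{0..}. X t \<omega>)
       (PiM {0..} (\<lambda>_. count_space T)) (\<lambda>\<omega>. \<lambda>t\<in>{0..}. Y t \<omega>)"

text \<open>States are numbered from \<open>1\<close>, list positions from \<open>0\<close>.\<close>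

definition matrix_of_rows :: "real list list \<Rightarrow> nat \<Rightarrow> nat \<Rightarrow> real" where
  "matrix_of_rows rs k l = rs ! (k - 1) ! (l - 1)"

end

theory Submission
  imports Defs
begin

text \<open>
  Independence of the two trajectories makes every conditional probability of the joint chain,
  given a finite joint history, the product of the corresponding conditional probabilities of the
  components. The Markov property and homogeneity of the joint chain are therefore inherited from
  the components.

  For the generator, write the transition probabilities of the components over a time step
  \<open>h\<close> as \<open>p\<^sub>a\<^sub>b(h)\<close> and \<open>q\<^sub>c\<^sub>d(h)\<close>. Then
  \[p_{ab} q_{cd} - \delta_{ab}\delta_{cd}
    = (p_{ab} - \delta_{ab}) q_{cd} + \delta_{ab} (q_{cd} - \delta_{cd}),\]
  and since \<open>q\<^sub>c\<^sub>d(h)\<close> tends to \<open>\<delta>\<^sub>c\<^sub>d\<close>, dividing by \<open>h\<close> and letting \<open>h\<close> decrease to \<open>0\<close>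
  shows that the generator of the joint chain is the Kronecker sum of the generators of the
  components (\<open>has_generator_joint\<close>). In particular simultaneous jumps have rate \<open>0\<close>. The matrix
  \<open>Q\<close> of the theorem is this Kronecker sum for two chains on \<open>{0, 1}\<close>.

  One point is specific to the formulation: a transition rate out of a state presupposes a time at
  which that state has positive probability, so the joint chain needs one time that serves both
  components. As all rates are positive, every state of either component is charged at all
  sufficiently small positive times (\<open>eventually_all_states_charged\<close>).
\<close>

section \<open>Short-time behaviour of a single chain\<close>

context ct_markov_chain
begin

lemma state_in_space: "0 \<le> t \<Longrightarrow> \<omega> \<in> space M \<Longrightarrow> X t \<omega> \<in> S"
  using measurable_space[OF random_state[of t]] by simp

lemma state_event [measurable]:
  assumes "0 \<le> t"
  shows "{\<omega> \<in> space M. X t \<omega> = k} \<in> events"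
proof -
  have "{\<omega> \<in> space M. X t \<omega> = k} = X t -` ({k} \<inter> S) \<inter> space M"
    using state_in_space[OF assms] by auto
  then show ?thesis
    using measurable_sets[OF random_state[OF assms], of "{k} \<inter> S"] by simp
qed

lemma sum_state_prob:
  assumes "0 \<le> t"
  shows "(\<Sum>l\<in>S. \<P>(\<omega> in M. X t \<omega> = l)) = 1"
  using prob_sum[of S "\<lambda>l \<omega>. X t \<omega> = l" "\<lambda>_. True"] finite_states
    state_event[OF assms] state_in_space[OF assms] by (auto simp: prob_space)

lemma sum_cond_prob:
  assumes s: "0 \<le> s" and t: "0 \<le> t" and pos: "\<P>(\<omega> in M. X t \<omega> = k) > 0"
  shows "(\<Sum>l\<in>S. \<P>(\<omega> in M. X s \<omega> = l \<bar> X t \<omega> = k)) = 1"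
proof -
  have "{\<omega> \<in> space M. X s \<omega> = l \<and> X t \<omega> = k} \<in> events" for l
    using sets.Int[OF state_event[OF s, of l] state_event[OF t, of k]]
    by (simp add: Int_def conj_ac cong: conj_cong)
  then have "\<P>(\<omega> in M. X t \<omega> = k) = (\<Sum>l\<in>S. \<P>(\<omega> in M. X s \<omega> = l \<and> X t \<omega> = k))"
    by (intro prob_sum) (use finite_states state_event[OF t] state_in_space[OF s] in auto)
  then show ?thesis
    using pos by (simp add: cond_prob_def flip: sum_divide_distrib)
qed

text \<open>
  Subtracting the identity matrix puts the diagonal on the same footing as the off-diagonal
  entries: the diagonal limit holds because both the transition matrix minus the identity and the
  generator have zero row sums.
\<close>

lemma transition_derivative:
  assumes gen: "has_generator M S X A" and t: "0 \<le> t" and pos: "\<P>(\<omega> in M. X t \<omega> = k) > 0"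
    and k: "k \<in> S" and l: "l \<in> S"
  shows "((\<lambda>h. (\<P>(\<omega> in M. X (t + h) \<omega> = l \<bar> X t \<omega> = k) - of_bool (k = l)) / h)
            \<longlongrightarrow> A k l) (at_right 0)"
proof -
  let ?p = "\<lambda>h l. \<P>(\<omega> in M. X (t + h) \<omega> = l \<bar> X t \<omega> = k)"
  have off: "((\<lambda>h. ?p h l / h) \<longlongrightarrow> A k l) (at_right 0)" if "l \<in> S - {k}" for l
    using gen k that t pos unfolding has_generator_def has_transition_rate_def by auto
  show ?thesis
  proof (cases "k = l")
    case False
    then show ?thesis using off[of l] l by simp
  next
    case True
    have "((\<lambda>h. - (\<Sum>l\<in>S - {k}. ?p h l / h)) \<longlongrightarrow> - (\<Sum>l\<in>S - {k}. A k l)) (at_right 0)"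
      by (intro tendsto_intros off)
    also have "- (\<Sum>l\<in>S - {k}. A k l) = A k k"
    proof -
      have "(\<Sum>l\<in>S. A k l) = 0"
        using gen k by (simp add: has_generator_def)
      then show ?thesis
        using sum.remove[OF finite_states k, of "A k"] by simp
    qed
    finally have "((\<lambda>h. - (\<Sum>l\<in>S - {k}. ?p h l / h)) \<longlongrightarrow> A k l) (at_right 0)"
      using True by simp
    then show ?thesis
    proof (rule Lim_transform_eventually)
      show "\<forall>\<^sub>F h in at_right 0. - (\<Sum>l\<in>S - {k}. ?p h l / h) = (?p h l - of_bool (k = l)) / h"
        using eventually_at_right_less[of 0]
      proof eventually_elim
        case (elim h)
        have "?p h k + (\<Sum>l\<in>S - {k}. ?p h l) = 1"
          using sum_cond_prob[of "t + h" t k] elim t pos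
            sum.remove[OF finite_states k, of "?p h"] by simp
        then have "?p h k - 1 = - (\<Sum>l\<in>S - {k}. ?p h l)" by simp
        then show ?case
          using True by (simp add: sum_divide_distrib)
      qed
    qed
  qed
qed

lemma transition_tendsto_identity:
  assumes "has_generator M S X A" "0 \<le> t" "\<P>(\<omega> in M. X t \<omega> = k) > 0" "k \<in> S" "l \<in> S"
  shows "((\<lambda>h. \<P>(\<omega> in M. X (t + h) \<omega> = l \<bar> X t \<omega> = k)) \<longlongrightarrow> of_bool (k = l)) (at_right 0)"
proof -
  let ?p = "\<lambda>h. \<P>(\<omega> in M. X (t + h) \<omega> = l \<bar> X t \<omega> = k)"
  have "((\<lambda>h. (?p h - of_bool (k = l)) / h * h + of_bool (k = l))
          \<longlongrightarrow> A k l * 0 + of_bool (k = l)) (at_right 0)"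
    by (intro tendsto_intros transition_derivative[OF assms])
  then have "((\<lambda>h. (?p h - of_bool (k = l)) / h * h + of_bool (k = l))
          \<longlongrightarrow> of_bool (k = l)) (at_right 0)" by simp
  then show ?thesis
    by (rule Lim_transform_eventually)
       (rule eventually_mono[OF eventually_at_right_less[of 0]], simp)
qed

text \<open>
  At time \<open>0\<close> some state is charged; from it the chain stays with probability close to \<open>1\<close> and
  jumps to any other state with probability asymptotic to a positive multiple of \<open>h\<close>.
\<close>

lemma eventually_all_states_charged:
  assumes gen: "has_generator M S X A"
    and rate_pos: "\<And>k l. k \<in> S \<Longrightarrow> l \<in> S \<Longrightarrow> k \<noteq> l \<Longrightarrow> A k l > 0"
  shows "\<forall>\<^sub>F h in at_right 0. \<forall>l\<in>S. \<P>(\<omega> in M. X h \<omega> = l) > 0"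
proof -
  have "(\<Sum>l\<in>S. \<P>(\<omega> in M. X 0 \<omega> = l)) > 0"
    using sum_state_prob[of 0] by simp
  then obtain k where k: "k \<in> S" and pos: "\<P>(\<omega> in M. X 0 \<omega> = k) > 0"
    by (meson not_le sum_nonpos)
  let ?p = "\<lambda>h l. \<P>(\<omega> in M. X h \<omega> = l \<bar> X 0 \<omega> = k)"
  have "\<forall>\<^sub>F h in at_right 0. \<P>(\<omega> in M. X h \<omega> = l) > 0" if l: "l \<in> S" for l
  proof -
    have "\<forall>\<^sub>F h in at_right 0. ?p h l > 0"
    proof (cases "k = l")
      case True
      then have "((\<lambda>h. ?p h l) \<longlongrightarrow> 1) (at_right 0)"
        using transition_tendsto_identity[OF gen _ pos k l] by simp
      then show ?thesis by (rule order_tendstoD) simp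
    next
      case False
      then have "((\<lambda>h. ?p h l / h) \<longlongrightarrow> A k l) (at_right 0)"
        using transition_derivative[OF gen _ pos k l] by simp
      then have "\<forall>\<^sub>F h in at_right 0. ?p h l / h > 0"
        by (rule order_tendstoD) (use rate_pos[OF k l False] in simp)
      then show ?thesis
        using eventually_at_right_less[of 0]
        by eventually_elim (auto simp: zero_less_divide_iff)
    qed
    then show ?thesis
      using eventually_at_right_less[of 0]
    proof eventually_elim
      case (elim h)
      have "0 < \<P>(\<omega> in M. X h \<omega> = l \<and> X 0 \<omega> = k)"
        using elim(1) pos by (simp add: cond_prob_def zero_less_divide_iff)
      also have "\<dots> \<le> \<P>(\<omega> in M. X h \<omega> = l)"
        by (intro finite_measure_mono state_event) (use elim in auto)
      finally show ?case .
    qed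
  qed
  then show ?thesis
    using finite_states by (simp add: eventually_ball_finite_distrib)
qed

end

section \<open>The joint chain of two independent chains\<close>

text \<open>
  The joint state is recorded through an injective labelling \<open>f\<close> of the pairs of states, so that
  any numbering of the product state space is covered.
\<close>

locale independent_chains =
  X: ct_markov_chain M S X + Y: ct_markov_chain M T Y
  for M :: "'a measure" and S :: "'s set" and X :: "real \<Rightarrow> 'a \<Rightarrow> 's"
    and T :: "'s set" and Y :: "real \<Rightarrow> 'a \<Rightarrow> 's" +
  fixes f :: "'s \<Rightarrow> 's \<Rightarrow> 'u" and Z :: "real \<Rightarrow> 'a \<Rightarrow> 'u"
  assumes indep: "indep_processes M S X T Y"
    and label_inj: "\<And>a b c d. \<lbrakk>a \<in> S; b \<in> S; c \<in> T; d \<in> T; f a c = f b d\<rbrakk> \<Longrightarrow> a = b \<and> c = d"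
    and joint: "\<And>t \<omega>. 0 \<le> t \<Longrightarrow> \<omega> \<in> space M \<Longrightarrow> Z t \<omega> = f (X t \<omega>) (Y t \<omega>)"
begin

abbreviation "labels \<equiv> (\<lambda>(a, c). f a c) ` (S \<times> T)"

lemma label_in_labels: "a \<in> S \<Longrightarrow> c \<in> T \<Longrightarrow> f a c \<in> labels"
  by auto

lemma joint_eq_iff:
  assumes "0 \<le> t" "\<omega> \<in> space M" "a \<in> S" "c \<in> T"
  shows "Z t \<omega> = f a c \<longleftrightarrow> X t \<omega> = a \<and> Y t \<omega> = c"
  using assms joint label_inj X.state_in_space Y.state_in_space by metis

lemma prob_trajectories:
  assumes P: "Measurable.pred (PiM {0..} (\<lambda>_. count_space S)) P"
    and R: "Measurable.pred (PiM {0..} (\<lambda>_. count_space T)) R"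
  shows "\<P>(\<omega> in M. P (\<lambda>t\<in>{0..}. X t \<omega>) \<and> R (\<lambda>t\<in>{0..}. Y t \<omega>)) =
    \<P>(\<omega> in M. P (\<lambda>t\<in>{0..}. X t \<omega>)) * \<P>(\<omega> in M. R (\<lambda>t\<in>{0..}. Y t \<omega>))"
proof -
  let ?MX = "PiM {0..} (\<lambda>_. count_space S)" and ?MY = "PiM {0..} (\<lambda>_. count_space T)"
  let ?X = "\<lambda>\<omega>. \<lambda>t\<in>{0..}. X t \<omega>" and ?Y = "\<lambda>\<omega>. \<lambda>t\<in>{0..}. Y t \<omega>"
  let ?A = "{g \<in> space ?MX. P g}" and ?B = "{g \<in> space ?MY. R g}"
  have sp: "?X \<omega> \<in> space ?MX" "?Y \<omega> \<in> space ?MY" if "\<omega> \<in> space M" for \<omega>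
    using that X.state_in_space Y.state_in_space by (auto simp: space_PiM)
  have "X.prob ((\<lambda>\<omega>. (?X \<omega>, ?Y \<omega>)) -` (?A \<times> ?B) \<inter> space M) =
      X.prob (?X -` ?A \<inter> space M) * X.prob (?Y -` ?B \<inter> space M)"
    using indep P R unfolding indep_processes_def pred_def by (rule X.indep_varD)
  moreover have "(\<lambda>\<omega>. (?X \<omega>, ?Y \<omega>)) -` (?A \<times> ?B) \<inter> space M =
      {\<omega> \<in> space M. P (?X \<omega>) \<and> R (?Y \<omega>)}"
    "?X -` ?A \<inter> space M = {\<omega> \<in> space M. P (?X \<omega>)}"
    "?Y -` ?B \<inter> space M = {\<omega> \<in> space M. R (?Y \<omega>)}"
    using sp by blast+
  ultimately show ?thesis by simp
qed

lemma prob_history: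
  assumes I: "finite I" "\<And>i. i \<in> I \<Longrightarrow> 0 \<le> t i"
    and "\<And>i. i \<in> I \<Longrightarrow> a i \<in> S" "\<And>i. i \<in> I \<Longrightarrow> c i \<in> T"
  shows "\<P>(\<omega> in M. \<forall>i\<in>I. Z (t i) \<omega> = f (a i) (c i)) =
    \<P>(\<omega> in M. \<forall>i\<in>I. X (t i) \<omega> = a i) * \<P>(\<omega> in M. \<forall>i\<in>I. Y (t i) \<omega> = c i)"
proof -
  let ?P = "\<lambda>g. \<forall>i\<in>I. g (t i) = a i" and ?R = "\<lambda>g. \<forall>i\<in>I. g (t i) = c i"
  have coord: "Measurable.pred (PiM {0..} (\<lambda>_. count_space U)) (\<lambda>g. \<forall>i\<in>I. g (t i) = b i)"
    for U :: "'v set" and b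
  proof (intro pred_intros_finite I)
    fix i assume "i \<in> I"
    then have "(\<lambda>g. g (t i)) \<in> measurable (PiM {0..} (\<lambda>_. count_space U)) (count_space U)"
      using I by (intro measurable_component_singleton) auto
    from measurable_compose[OF this, of "\<lambda>v. v = b i" "count_space UNIV"]
    show "Measurable.pred (PiM {0..} (\<lambda>_. count_space U)) (\<lambda>g. g (t i) = b i)" by simp
  qed
  have "\<P>(\<omega> in M. \<forall>i\<in>I. Z (t i) \<omega> = f (a i) (c i)) =
      \<P>(\<omega> in M. ?P (\<lambda>t\<in>{0..}. X t \<omega>) \<and> ?R (\<lambda>t\<in>{0..}. Y t \<omega>))"
    using assms joint_eq_iff by (intro arg_cong[where f = X.prob]) (auto simp: ball_conj_distrib)
  also have "\<dots> = \<P>(\<omega> in M. ?P (\<lambda>t\<in>{0..}. X t \<omega>)) * \<P>(\<omega> in M. ?R (\<lambda>t\<in>{0..}. Y t \<omega>))"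
    by (rule prob_trajectories[OF coord coord])
  also have "\<dots> = \<P>(\<omega> in M. \<forall>i\<in>I. X (t i) \<omega> = a i) * \<P>(\<omega> in M. \<forall>i\<in>I. Y (t i) \<omega> = c i)"
    using I by simp
  finally show ?thesis .
qed

text \<open>
  Null histories need no exception: if one of the two component histories is null, then so is
  the joint one, and both sides are \<open>0\<close>.
\<close>

lemma cond_prob_history:
  assumes "finite I" "\<And>i. i \<in> insert j I \<Longrightarrow> 0 \<le> t i"
    and "\<And>i. i \<in> insert j I \<Longrightarrow> a i \<in> S" "\<And>i. i \<in> insert j I \<Longrightarrow> c i \<in> T"
  shows "\<P>(\<omega> in M. Z (t j) \<omega> = f (a j) (c j) \<bar> \<forall>i\<in>I. Z (t i) \<omega> = f (a i) (c i)) =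
    \<P>(\<omega> in M. X (t j) \<omega> = a j \<bar> \<forall>i\<in>I. X (t i) \<omega> = a i) *
    \<P>(\<omega> in M. Y (t j) \<omega> = c j \<bar> \<forall>i\<in>I. Y (t i) \<omega> = c i)"
  using prob_history[of I t a c] prob_history[of "insert j I" t a c] assms
  by (simp add: cond_prob_def)

lemma prob_state:
  assumes "0 \<le> t" "a \<in> S" "c \<in> T"
  shows "\<P>(\<omega> in M. Z t \<omega> = f a c) = \<P>(\<omega> in M. X t \<omega> = a) * \<P>(\<omega> in M. Y t \<omega> = c)"
  using prob_history[of "{()}" "\<lambda>_. t" "\<lambda>_. a" "\<lambda>_. c"] assms by simp

lemma prob_state_pos_iff:
  assumes "0 \<le> t" "a \<in> S" "c \<in> T"
  shows "\<P>(\<omega> in M. Z t \<omega> = f a c) > 0 \<longleftrightarrow>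
    \<P>(\<omega> in M. X t \<omega> = a) > 0 \<and> \<P>(\<omega> in M. Y t \<omega> = c) > 0"
  unfolding prob_state[OF assms] by (simp add: zero_less_mult_iff)

lemma cond_prob_state:
  assumes "0 \<le> s" "0 \<le> t" "a \<in> S" "b \<in> S" "c \<in> T" "d \<in> T"
  shows "\<P>(\<omega> in M. Z s \<omega> = f b d \<bar> Z t \<omega> = f a c) =
    \<P>(\<omega> in M. X s \<omega> = b \<bar> X t \<omega> = a) * \<P>(\<omega> in M. Y s \<omega> = d \<bar> Y t \<omega> = c)"
  using cond_prob_history[of "{0 :: nat}" 1 "\<lambda>i. if i = 0 then t else s"
      "\<lambda>i. if i = 0 then a else b" "\<lambda>i. if i = 0 then c else d"] assms by simp

theorem ct_markov_chain_joint: "ct_markov_chain M labels Z"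
proof
  show "finite labels"
    using X.finite_states Y.finite_states by simp
next
  fix t :: real assume t: "0 \<le> t"
  have "Z t -` {f a c} \<inter> space M \<in> X.events" if "a \<in> S" "c \<in> T" for a c
  proof -
    have "Z t -` {f a c} \<inter> space M =
        {\<omega> \<in> space M. X t \<omega> = a} \<inter> {\<omega> \<in> space M. Y t \<omega> = c}"
      using joint_eq_iff[OF t] that by auto
    then show ?thesis
      using X.state_event[OF t] Y.state_event[OF t] by simp
  qed
  then show "Z t \<in> measurable M (count_space labels)"
    using X.finite_states Y.finite_states joint[OF t] X.state_in_space[OF t] Y.state_in_space[OF t]
    by (subst measurable_count_space_eq2) (auto intro!: label_in_labels)
next
  fix n :: nat and t :: "nat \<Rightarrow> real" and x
  assume t0: "0 \<le> t 0" and inc: "\<And>i. i \<le> n \<Longrightarrow> t i < t (Suc i)"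
    and x: "\<And>i. i \<le> Suc n \<Longrightarrow> x i \<in> labels"
    and pos: "\<P>(\<omega> in M. \<forall>i\<le>n. Z (t i) \<omega> = x i) > 0"
  have t: "0 \<le> t i" if "i \<le> Suc n" for i
    using that
  proof (induction i)
    case (Suc i)
    then show ?case using inc[of i] by simp
  qed (rule t0)
  have "\<exists>a c. a \<in> S \<and> c \<in> T \<and> x i = f a c" if "i \<le> Suc n" for i
    using x[OF that] by auto
  then obtain a c where a: "\<And>i. i \<le> Suc n \<Longrightarrow> a i \<in> S" and c: "\<And>i. i \<le> Suc n \<Longrightarrow> c i \<in> T"
    and x_eq: "\<And>i. i \<le> Suc n \<Longrightarrow> x i = f (a i) (c i)"
    by metis
  have hist: "(\<forall>i\<le>n. Z (t i) \<omega> = x i) \<longleftrightarrow> (\<forall>i\<in>{..n}. Z (t i) \<omega> = f (a i) (c i))" for \<omega>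
    using x_eq by auto
  have "\<P>(\<omega> in M. \<forall>i\<in>{..n}. X (t i) \<omega> = a i) * \<P>(\<omega> in M. \<forall>i\<in>{..n}. Y (t i) \<omega> = c i) > 0"
    using pos prob_history[of "{..n}" t a c] t a c by (simp only: hist) simp
  then have posX: "\<P>(\<omega> in M. \<forall>i\<le>n. X (t i) \<omega> = a i) > 0"
    and posY: "\<P>(\<omega> in M. \<forall>i\<le>n. Y (t i) \<omega> = c i) > 0"
    by (simp_all add: zero_less_mult_iff Ball_def)
  have "\<P>(\<omega> in M. Z (t (Suc n)) \<omega> = x (Suc n) \<bar> \<forall>i\<le>n. Z (t i) \<omega> = x i) =
      \<P>(\<omega> in M. X (t (Suc n)) \<omega> = a (Suc n) \<bar> \<forall>i\<le>n. X (t i) \<omega> = a i) *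
      \<P>(\<omega> in M. Y (t (Suc n)) \<omega> = c (Suc n) \<bar> \<forall>i\<le>n. Y (t i) \<omega> = c i)"
    using cond_prob_history[of "{..n}" "Suc n" t a c] t a c by (simp add: hist x_eq Ball_def flip: atMost_Suc)
  also have "\<dots> =
      \<P>(\<omega> in M. X (t (Suc n)) \<omega> = a (Suc n) \<bar> X (t n) \<omega> = a n) *
      \<P>(\<omega> in M. Y (t (Suc n)) \<omega> = c (Suc n) \<bar> Y (t n) \<omega> = c n)"
    using X.markov[OF t0 inc a posX] Y.markov[OF t0 inc c posY] by simp
  also have "\<dots> = \<P>(\<omega> in M. Z (t (Suc n)) \<omega> = x (Suc n) \<bar> Z (t n) \<omega> = x n)"
    using cond_prob_state t a c by (simp add: x_eq)
  finally show "\<P>(\<omega> in M. Z (t (Suc n)) \<omega> = x (Suc n) \<bar> \<forall>i\<le>n. Z (t i) \<omega> = x i) =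
      \<P>(\<omega> in M. Z (t (Suc n)) \<omega> = x (Suc n) \<bar> Z (t n) \<omega> = x n)" .
next
  fix s t h :: real and k l
  assume s: "0 \<le> s" and t: "0 \<le> t" and h: "0 \<le> h" and "k \<in> labels" "l \<in> labels"
    and pos: "\<P>(\<omega> in M. Z s \<omega> = k) > 0" "\<P>(\<omega> in M. Z t \<omega> = k) > 0"
  then obtain a b c d where abcd: "a \<in> S" "b \<in> S" "c \<in> T" "d \<in> T"
    and kl: "k = f a c" "l = f b d"
    by auto
  then show "\<P>(\<omega> in M. Z (s + h) \<omega> = l \<bar> Z s \<omega> = k) = \<P>(\<omega> in M. Z (t + h) \<omega> = l \<bar> Z t \<omega> = k)"
    using pos s t h X.homogeneous[of s t h a b] Y.homogeneous[of s t h c d]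
    by (simp add: cond_prob_state prob_state_pos_iff)
qed

text \<open>
  The entries prescribed for \<open>Q\<close> are those of the Kronecker sum of \<open>A\<close> and \<open>B\<close>. The
  hypothesis \<open>charged\<close> cannot be read off from the generators, which only provide separate
  times for the two components.
\<close>

theorem has_generator_joint:
  assumes A: "has_generator M S X A" and B: "has_generator M T Y B"
    and charged: "\<And>a c. a \<in> S \<Longrightarrow> c \<in> T \<Longrightarrow>
      \<exists>t\<ge>0. \<P>(\<omega> in M. X t \<omega> = a) > 0 \<and> \<P>(\<omega> in M. Y t \<omega> = c) > 0"
    and Q: "\<And>a b c d. \<lbrakk>a \<in> S; b \<in> S; c \<in> T; d \<in> T\<rbrakk> \<Longrightarrow>
      Q (f a c) (f b d) = A a b * of_bool (c = d) + of_bool (a = b) * B c d"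
  shows "has_generator M labels Z Q"
  unfolding has_generator_def
proof (intro conjI ballI impI)
  fix k l assume "k \<in> labels" "l \<in> labels" and ne: "k \<noteq> l"
  then obtain a b c d where abcd: "a \<in> S" "b \<in> S" "c \<in> T" "d \<in> T"
    and kl: "k = f a c" "l = f b d"
    by auto
  show "has_transition_rate M Z k l (Q k l)"
    unfolding has_transition_rate_def
  proof (intro conjI allI impI)
    show "\<exists>t\<ge>0. \<P>(\<omega> in M. Z t \<omega> = k) > 0"
      using charged[of a c] abcd kl by (auto simp: prob_state_pos_iff)
  next
    fix t :: real assume t: "0 \<le> t" and "\<P>(\<omega> in M. Z t \<omega> = k) > 0"
    then have pos: "\<P>(\<omega> in M. X t \<omega> = a) > 0" "\<P>(\<omega> in M. Y t \<omega> = c) > 0"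
      using abcd kl by (simp_all add: prob_state_pos_iff)
    let ?p = "\<lambda>h. \<P>(\<omega> in M. X (t + h) \<omega> = b \<bar> X t \<omega> = a)"
    let ?q = "\<lambda>h. \<P>(\<omega> in M. Y (t + h) \<omega> = d \<bar> Y t \<omega> = c)"
    have "((\<lambda>h. (?p h - of_bool (a = b)) / h * ?q h + of_bool (a = b) * ((?q h - of_bool (c = d)) / h))
        \<longlongrightarrow> A a b * of_bool (c = d) + of_bool (a = b) * B c d) (at_right 0)"
      using abcd t pos A B
      by (intro tendsto_intros X.transition_derivative Y.transition_derivative
          Y.transition_tendsto_identity)
    then have "((\<lambda>h. (?p h - of_bool (a = b)) / h * ?q h + of_bool (a = b) * ((?q h - of_bool (c = d)) / h))
        \<longlongrightarrow> Q k l) (at_right 0)"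
      using Q abcd kl by simp
    then show "((\<lambda>h. \<P>(\<omega> in M. Z (t + h) \<omega> = l \<bar> Z t \<omega> = k) / h) \<longlongrightarrow> Q k l) (at_right 0)"
    proof (rule Lim_transform_eventually)
      have "of_bool (a = b) * of_bool (c = d) = (0 :: real)"
        using ne kl by auto
      then have "(?p h - of_bool (a = b)) / h * ?q h + of_bool (a = b) * ((?q h - of_bool (c = d)) / h)
          = ?p h * ?q h / h" for h
        by (simp add: algebra_simps flip: add_divide_distrib diff_divide_distrib)
      moreover have "\<P>(\<omega> in M. Z (t + h) \<omega> = l \<bar> Z t \<omega> = k) = ?p h * ?q h" if "0 < h" for h
        using cond_prob_state[of "t + h" t a b c d] t that abcd kl by simp
      ultimately show "\<forall>\<^sub>F h in at_right 0.
          (?p h - of_bool (a = b)) / h * ?q h + of_bool (a = b) * ((?q h - of_bool (c = d)) / h)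
          = \<P>(\<omega> in M. Z (t + h) \<omega> = l \<bar> Z t \<omega> = k) / h"
        using eventually_at_right_less[of 0] by (auto elim!: eventually_mono)
    qed
  qed
next
  fix k assume "k \<in> labels"
  then obtain a c where ac: "a \<in> S" "c \<in> T" and k: "k = f a c"
    by auto
  have "inj_on (\<lambda>(b, d). f b d) (S \<times> T)"
    using label_inj by (auto simp: inj_on_def)
  then have "(\<Sum>l\<in>labels. Q k l) = (\<Sum>(b, d)\<in>S \<times> T. Q k (f b d))"
    by (simp add: sum.reindex case_prod_unfold)
  also have "\<dots> = (\<Sum>b\<in>S. \<Sum>d\<in>T. A a b * of_bool (c = d) + of_bool (a = b) * B c d)"
    unfolding sum.cartesian_product[symmetric] k by (intro sum.cong refl Q ac)
  also have "\<dots> = (\<Sum>b\<in>S. A a b) * (\<Sum>d\<in>T. of_bool (c = d)) +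
      (\<Sum>b\<in>S. of_bool (a = b)) * (\<Sum>d\<in>T. B c d)"
    by (simp only: sum.distrib sum_product)
  also have "\<dots> = 0"
    using A B ac by (simp add: has_generator_def)
  finally show "(\<Sum>l\<in>labels. Q k l) = 0" .
qed

end

section \<open>Two two-state chains\<close>

definition two_state_matrix :: "real \<Rightarrow> real \<Rightarrow> nat \<Rightarrow> nat \<Rightarrow> real" where
  "two_state_matrix p q k l = [[- p, p], [q, - q]] ! k ! l"

lemma has_generator_two_state:
  assumes "has_transition_rate M X 0 1 p" "has_transition_rate M X 1 0 q"
  shows "has_generator M {0, 1} X (two_state_matrix p q)"
  using assms by (simp add: has_generator_def two_state_matrix_def)

theorem mainTheorem5:
  fixes M :: "'a measure"
    and \<epsilon> \<zeta> \<xi> :: "real \<Rightarrow> 'a \<Rightarrow> nat"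
    and lam1\<epsilon> lam2\<epsilon> lam1\<zeta> lam2\<zeta> :: real
  assumes "ct_markov_chain M {0, 1} \<epsilon>"
    and "ct_markov_chain M {0, 1} \<zeta>"
    and "indep_processes M {0, 1} \<epsilon> {0, 1} \<zeta>"
    and "lam1\<epsilon> > 0" and "lam2\<epsilon> > 0" and "lam1\<zeta> > 0" and "lam2\<zeta> > 0"
    and "has_transition_rate M \<epsilon> 0 1 lam1\<epsilon>"
    and "has_transition_rate M \<epsilon> 1 0 lam2\<epsilon>"
    and "has_transition_rate M \<zeta> 0 1 lam1\<zeta>"
    and "has_transition_rate M \<zeta> 1 0 lam2\<zeta>"
    and "\<And>t \<omega>. \<lbrakk>0 \<le> t; \<omega> \<in> space M; (\<epsilon> t \<omega>, \<zeta> t \<omega>) = (0, 0)\<rbrakk> \<Longrightarrow> \<xi> t \<omega> = 1"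
    and "\<And>t \<omega>. \<lbrakk>0 \<le> t; \<omega> \<in> space M; (\<epsilon> t \<omega>, \<zeta> t \<omega>) = (1, 0)\<rbrakk> \<Longrightarrow> \<xi> t \<omega> = 2"
    and "\<And>t \<omega>. \<lbrakk>0 \<le> t; \<omega> \<in> space M; (\<epsilon> t \<omega>, \<zeta> t \<omega>) = (0, 1)\<rbrakk> \<Longrightarrow> \<xi> t \<omega> = 3"
    and "\<And>t \<omega>. \<lbrakk>0 \<le> t; \<omega> \<in> space M; (\<epsilon> t \<omega>, \<zeta> t \<omega>) = (1, 1)\<rbrakk> \<Longrightarrow> \<xi> t \<omega> = 4"
  shows "ct_markov_chain M {1, 2, 3, 4} \<xi> \<and>
    has_generator M {1, 2, 3, 4} \<xi> (matrix_of_rows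
      [[-(lam1\<epsilon> + lam1\<zeta>), lam1\<epsilon>, lam1\<zeta>, 0],
       [lam2\<epsilon>, -(lam2\<epsilon> + lam1\<zeta>), 0, lam1\<zeta>],
       [lam2\<zeta>, 0, -(lam1\<epsilon> + lam2\<zeta>), lam1\<epsilon>],
       [0, lam2\<zeta>, lam2\<epsilon>, -(lam2\<epsilon> + lam2\<zeta>)]])"
proof -
  interpret E: ct_markov_chain M "{0, 1}" \<epsilon> by fact
  interpret D: ct_markov_chain M "{0, 1}" \<zeta> by fact
  \<comment> \<open>On \<open>{0, 1}\<close> the numbering of the four joint states is affine.\<close>
  define f :: "nat \<Rightarrow> nat \<Rightarrow> nat" where "f a c = 1 + a + 2 * c" for a c
  have "\<xi> t \<omega> = f (\<epsilon> t \<omega>) (\<zeta> t \<omega>)" if "0 \<le> t" "\<omega> \<in> space M" for t \<omega>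
    using E.state_in_space[OF that] D.state_in_space[OF that] assms(12-15)[OF that]
    by (auto simp: f_def)
  then interpret independent_chains M "{0, 1}" \<epsilon> "{0, 1}" \<zeta> f \<xi>
    by unfold_locales (use assms(3) in \<open>auto simp: f_def\<close>)
  have labels: "labels = {1, 2, 3, 4}"
    by (auto simp: f_def)
  note gen\<epsilon> = has_generator_two_state[OF assms(8,9)]
    and gen\<zeta> = has_generator_two_state[OF assms(10,11)]
  have "\<forall>\<^sub>F h in at_right 0. \<forall>a\<in>{0, 1}. \<P>(\<omega> in M. \<epsilon> h \<omega> = a) > 0"
    by (rule E.eventually_all_states_charged[OF gen\<epsilon>])
       (use assms(4,5) in \<open>auto simp: two_state_matrix_def\<close>)
  moreover have "\<forall>\<^sub>F h in at_right 0. \<forall>c\<in>{0, 1}. \<P>(\<omega> in M. \<zeta> h \<omega> = c) > 0"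
    by (rule D.eventually_all_states_charged[OF gen\<zeta>])
       (use assms(6,7) in \<open>auto simp: two_state_matrix_def\<close>)
  ultimately have "\<forall>\<^sub>F h in at_right (0::real). 0 < h \<and>
      (\<forall>a\<in>{0, 1}. \<P>(\<omega> in M. \<epsilon> h \<omega> = a) > 0) \<and> (\<forall>c\<in>{0, 1}. \<P>(\<omega> in M. \<zeta> h \<omega> = c) > 0)"
    using eventually_at_right_less[of 0] by eventually_elim blast
  then obtain h where h: "0 < h" "\<And>a. a \<in> {0, 1} \<Longrightarrow> \<P>(\<omega> in M. \<epsilon> h \<omega> = a) > 0"
    "\<And>c. c \<in> {0, 1} \<Longrightarrow> \<P>(\<omega> in M. \<zeta> h \<omega> = c) > 0"
    using eventually_happens'[OF trivial_limit_at_right_real] by blast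
  have "has_generator M labels \<xi> (matrix_of_rows
      [[-(lam1\<epsilon> + lam1\<zeta>), lam1\<epsilon>, lam1\<zeta>, 0],
       [lam2\<epsilon>, -(lam2\<epsilon> + lam1\<zeta>), 0, lam1\<zeta>],
       [lam2\<zeta>, 0, -(lam1\<epsilon> + lam2\<zeta>), lam1\<epsilon>],
       [0, lam2\<zeta>, lam2\<epsilon>, -(lam2\<epsilon> + lam2\<zeta>)]])"
  proof (rule has_generator_joint[OF gen\<epsilon> gen\<zeta>])
    show "\<exists>t\<ge>0. \<P>(\<omega> in M. \<epsilon> t \<omega> = a) > 0 \<and> \<P>(\<omega> in M. \<zeta> t \<omega> = c) > 0"
      if "a \<in> {0, 1}" "c \<in> {0, 1}" for a c
      using h that by (intro exI[of _ h]) auto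
  qed (auto simp: matrix_of_rows_def two_state_matrix_def f_def)
  then show ?thesis
    using ct_markov_chain_joint unfolding labels by blast
qed

end
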